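(* Let $x^1,\dots,x^{n_f}\in\mathbb{R}^3$ be fixed contact points, let the random normals $n^1,\dots,n^{n_f}$ be mutually independent with $n^i=\bar n^i+\mathcal{T}_i\epsilon^i$, $\epsilon^i\sim\mathcal{N}(0,\Sigma^i)$, where $\bar n^i$ is the mean normal and the columns of $\mathcal{T}_i\in\mathbb{R}^{3\times 2}$ form a basis of the plane orthogonal to $\bar n^i$. Let $p(n^i)$ denote the resulting density of $n^i$ on the affine plane $\Pi_i=\bar n^i+\operatorname{range}(\mathcal{T}_i)$. Let $\bar w^i_j=T^i_j\bar n^i$ and $w^i_j=T^i_j n^i$ ($1\le i\le n_f$, $1\le j\le n_s$) be the mean and random basis wrenches, let $\mathcal{C}_{\bar w}$ and $\mathcal{C}_w$ be the convex hulls of the finite sets of all $\bar w^i_j$ and of all $w^i_j$ respectively, let $$\mathfrak{N}=\{(n^1,\dots,n^{n_f})\in\Pi_1\times\cdots\times\Pi_{n_f} : 0\in\mathcal{C}_w\},$$ and let $P_{\mathrm{fc}}=\mathbb{P}[0\in\mathcal{C}_w]=\int_{\mathfrak{N}}\prod_{i=1}^{n_f}p(n^i)\,dn^i$. (a) Suppose that for each $i$, $\mathcal{A}_i\subseteq\Pi_i$ is a measurable set with $$\mathcal{A}_i\subseteq\{n^i\in\Pi_i : T^i_j(n^i-\bar n^i)\in-\mathcal{C}_{\bar w}\ \text{for all } j=1,\dots,n_s\},$$ and put $\mathcal{A}=\mathcal{A}_1\times\cdots\times\mathcal{A}_{n_f}$. Then $\mathcal{A}\subseteq\mathfrak{N}$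 and $$L_{\mathrm{fc}}:=\prod_{i=1}^{n_f}\int_{\mathcal{A}_i}p(n^i)\,dn^i=\int_{\mathcal{A}}\prod_{i=1}^{n_f}p(n^i)\,dn^i\le\int_{\mathfrak{N}}\prod_{i=1}^{n_f}p(n^i)\,dn^i=P_{\mathrm{fc}}.$$ (b) For each $i$ let $d^{i,k}\in\operatorname{range}(\mathcal{T}_i)$, $k=1,\dots,n_v$, be nonzero search directions such that every linear program $\mathrm{VLP}^{i,k}$ is feasible, let $\theta^{i,k}$ be its optimal value, let $v^{i,k}=\theta^{i,k}d^{i,k}$, and let $\mathcal{A}_i=\bar n^i+\operatorname{conv}\{v^{i,1},\dots,v^{i,n_v}\}$. Then the sets $\mathcal{A}_i$ satisfy the inclusion required in (a), so that $L_{\mathrm{fc}}\le P_{\mathrm{fc}}$ for this choice.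
   Context: Notation. For $a\in\mathbb{R}^3$, $[a]_\times\in\mathbb{R}^{3\times3}$ is the matrix with $[a]_\times b=a\times b$. $n_f$ is the number of fingers (contacts), $n_s$ the number of edges of each pyramidal friction cone approximation, and $n_w=n_fn_s$. $\mu>0$ is a fixed friction coefficient. Mean normals $\bar n^i\in\mathbb{R}^3$ are unit vectors. For each $i,j$, a generator $\bar g^i_j\in\mathbb{R}^3$ is a fixed unit vector orthogonal to $\bar n^i$ (it depends only on the mean normal, not on the random normal). Define $$T^i_j=\begin{bmatrix} I+\mu[\bar g^i_j]_\times\\ [x^i]_\times\left(I+\mu[\bar g^i_j]_\times\right)\end{bmatrix}\in\mathbb{R}^{6\times3}.$$ The covariances $\Sigma^i\in\mathbb{R}^{2\times2}$ are symmetric positive definite. Integrals $dn^i$ are with respect to two-dimensional Lebesgue measure on the plane $\Pi_i$. The condition $0\in\mathcal{C}_w$ is the sufficient condition by which the basis wrenches are said to certify force closure, and $P_{\mathrm{fc}}$ is called the probability of force closure. $\mathrm{VLP}^{i,k}$: let $\overline{W}\in\mathbb{R}^{6\times n_w}$ be the matrix whose columns are all the mean basis wrenches $\bar w^i_j$. $\mathrm{VLP}^{i,k}$ is the linear program that maximizes $\theta\in\mathbb{R}$ over $\theta\in\mathbb{R}$ and $\alpha_1,\dots,\alpha_{n_s}\in\mathbb{R}^{n_w}$ subject to $\theta\ge0$; and, for all $j=1,\dots,n_s$: $\alpha_j\ge0$ componentwise, $\mathbf{1}^\top\alpha_j=1$, and $T^i_j(\theta d^{i,k})=-\overline{W}\alpha_j$.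 *)

theory Defs
  imports "HOL-Probability.Probability" "HOL-Analysis.Cross3"
begin

text \<open>Fingers and friction-cone edges are indexed by finite types \<open>'f\<close> and \<open>'s\<close>,
  so \<open>n_f = CARD('f)\<close>, \<open>n_s = CARD('s)\<close> and \<open>\<real>\<^bsup>n_w\<^esup>\<close> is \<open>real ^ ('f \<times> 's)\<close>.
  Wrenches live in \<open>real ^ (3 + 3)\<close>; the sum type \<open>3 + 3\<close> has six elements, the
  force components being indexed by \<open>Inl\<close> and the torque components by \<open>Inr\<close>.\<close>

definition skew :: "real^3 \<Rightarrow> real^3^3" where
  "skew a = matrix (cross3 a)"

lemma skew_mult: "skew a *v b = cross3 a b"
proof -
  have "linear (cross3 a)"
    by (simp add: linear_iff cross_add_right cross_mult_right)
  then show ?thesis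
    by (simp add: skew_def matrix_works linear_matrix_vector_mul_eq)
qed

definition stack :: "real^'n^'a \<Rightarrow> real^'n^'b \<Rightarrow> real^'n^('a + 'b)" where
  "stack A B = (\<chi> r. case r of Inl a \<Rightarrow> A $ a | Inr b \<Rightarrow> B $ b)"

definition wrench_matrix :: "real \<Rightarrow> real^3 \<Rightarrow> real^3 \<Rightarrow> real^3^(3+3)" where
  "wrench_matrix \<mu> x g =
     stack (mat 1 + \<mu> *\<^sub>R skew g) (skew x ** (mat 1 + \<mu> *\<^sub>R skew g))"

text \<open>The random normals instead of the mean normals may be plugged in for \<open>n\<close>; the
  generators \<open>g\<close> are not affected by this.\<close>

definition basis_wrench ::
  "real \<Rightarrow> ('f \<Rightarrow> real^3) \<Rightarrow> ('f \<Rightarrow> 's \<Rightarrow> real^3) \<Rightarrow> ('f \<Rightarrow> real^3) \<Rightarrow> 'f \<Rightarrow> 's \<Rightarrow> real^(3+3)"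
where
  "basis_wrench \<mu> x g n i j = wrench_matrix \<mu> (x i) (g i j) *v n i"

definition wrench_hull ::
  "real \<Rightarrow> ('f \<Rightarrow> real^3) \<Rightarrow> ('f \<Rightarrow> 's \<Rightarrow> real^3) \<Rightarrow> ('f \<Rightarrow> real^3) \<Rightarrow> (real^(3+3)) set"
where
  "wrench_hull \<mu> x g n = convex hull {basis_wrench \<mu> x g n i j | i j. True}"

definition basis_wrench_columns ::
  "real \<Rightarrow> ('f::finite \<Rightarrow> real^3) \<Rightarrow> ('f \<Rightarrow> 's::finite \<Rightarrow> real^3) \<Rightarrow> ('f \<Rightarrow> real^3)
    \<Rightarrow> real^('f \<times> 's)^(3+3)"
where
  "basis_wrench_columns \<mu> x g n = (\<chi> r p. basis_wrench \<mu> x g n (fst p) (snd p) $ r)"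

definition vlp_feasible ::
  "real \<Rightarrow> ('f::finite \<Rightarrow> real^3) \<Rightarrow> ('f \<Rightarrow> 's::finite \<Rightarrow> real^3) \<Rightarrow> ('f \<Rightarrow> real^3)
    \<Rightarrow> 'f \<Rightarrow> real^3 \<Rightarrow> real \<Rightarrow> ('s \<Rightarrow> real^('f \<times> 's)) \<Rightarrow> bool"
where
  "vlp_feasible \<mu> x g nbar i d \<theta> \<alpha> \<longleftrightarrow>
     \<theta> \<ge> 0 \<and>
     (\<forall>j. (\<forall>p. \<alpha> j $ p \<ge> 0) \<and> (\<Sum>p\<in>UNIV. \<alpha> j $ p) = 1 \<and>
          wrench_matrix \<mu> (x i) (g i j) *v (\<theta> *\<^sub>R d) =
            - (basis_wrench_columns \<mu> x g nbar *v \<alpha> j))"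

text \<open>The supremum is taken in \<open>\<real>\<close>. For \<open>d \<noteq> 0\<close> it is not a default value once the program
  is feasible: the wrench matrices are injective and the convex hull of the mean basis wrenches
  is compact, so the feasible values of \<open>\<theta>\<close> form a compact set.\<close>

definition vlp_value ::
  "real \<Rightarrow> ('f::finite \<Rightarrow> real^3) \<Rightarrow> ('f \<Rightarrow> 's::finite \<Rightarrow> real^3) \<Rightarrow> ('f \<Rightarrow> real^3)
    \<Rightarrow> 'f \<Rightarrow> real^3 \<Rightarrow> real"
where
  "vlp_value \<mu> x g nbar i d = Sup {\<theta>. \<exists>\<alpha>. vlp_feasible \<mu> x g nbar i d \<theta> \<alpha>}"

definition sym_pos_def :: "real^'n^'n \<Rightarrow> bool" where
  "sym_pos_def S \<longleftrightarrow> transpose S = S \<and> (\<forall>v. v \<noteq> 0 \<longrightarrow> v \<bullet> (S *v v) > 0)"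

definition centered_normal_density :: "real^'n^'n \<Rightarrow> real^'n \<Rightarrow> real" where
  "centered_normal_density S u =
     exp (- (u \<bullet> (matrix_inv S *v u)) / 2) / sqrt ((2 * pi) ^ CARD('n) * det S)"

definition affine_plane :: "real^3 \<Rightarrow> real^2^3 \<Rightarrow> (real^3) set" where
  "affine_plane c B = {c + B *v u | u. True}"

text \<open>Two-dimensional Lebesgue measure on \<open>affine_plane c B\<close>, as a measure on \<open>\<real>\<^sup>3\<close> carried by
  that plane. The factor is the area of the parallelogram spanned by the columns of \<open>B\<close>; the
  lemma \<open>plane_lborel_isometry\<close> shows that the choice of the basis is immaterial and that an
  isometric parametrization of the plane transports \<open>lborel\<close> to this measure.
  As for \<open>lborel\<close> and \<open>lebesgue\<close>, the second measure is the completion of the first.\<close>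

definition plane_lborel :: "real^3 \<Rightarrow> real^2^3 \<Rightarrow> (real^3) measure" where
  "plane_lborel c B =
     scale_measure (ennreal (sqrt (det (transpose B ** B))))
       (distr lborel borel (\<lambda>u. c + B *v u))"

definition plane_lebesgue :: "real^3 \<Rightarrow> real^2^3 \<Rightarrow> (real^3) measure" where
  "plane_lebesgue c B = completion (plane_lborel c B)"

lemma emeasure_matrix_preimage:
  fixes C :: "real^2^2"
  assumes "invertible C"
  shows "ennreal \<bar>det C\<bar> * emeasure lborel ((*v) C -` box l u) = emeasure lborel (box l u)"
proof -
  let ?E = "(*v) C -` box l u"
  obtain D where D: "D ** C = mat 1" "C ** D = mat 1" using assms by (auto simp: invertible_def)
  have img: "(*v) C ` ?E = box l u"
  proof (intro set_eqI iffI)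
    fix v assume v: "v \<in> box l u"
    have "v = C *v (D *v v)" by (simp add: matrix_vector_mul_assoc D)
    with v show "v \<in> (*v) C ` ?E" by (metis image_eqI vimage_eq)
  qed blast
  have E: "?E = (*v) D ` box l u"
  proof (intro set_eqI iffI)
    fix v assume "v \<in> ?E"
    moreover have "v = D *v (C *v v)" by (simp add: matrix_vector_mul_assoc D)
    ultimately show "v \<in> (*v) D ` box l u" by blast
  next
    fix v assume "v \<in> (*v) D ` box l u"
    then show "v \<in> ?E" by (auto simp: matrix_vector_mul_assoc D)
  qed
  have "bounded ?E" unfolding E by (intro bounded_linear_image bounded_box matrix_vector_mul_bounded_linear)
  moreover have op: "open ?E"
    by (intro open_vimage open_box linear_continuous_on matrix_vector_mul_bounded_linear)
  ultimately have lm: "?E \<in> lmeasurable" by (rule lmeasurable_open)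
  have m: "measure lebesgue (box l u) = \<bar>det C\<bar> * measure lebesgue ?E"
    using measure_linear_image[OF matrix_vector_mul_linear[of C] lm] by (simp only: img matrix_of_matrix_vector_mul)
  have "emeasure lebesgue (box l u) = ennreal (\<bar>det C\<bar> * measure lebesgue ?E)"
    by (simp only: emeasure_eq_measure2[OF lmeasurable_box] m)
  also have "\<dots> = ennreal \<bar>det C\<bar> * emeasure lebesgue ?E"
    using lm by (simp add: ennreal_mult emeasure_eq_measure2)
  finally show ?thesis using op by (simp add: borel_open)
qed

lemma lborel_matrix:
  fixes C :: "real^2^2"
  assumes "invertible C"
  shows "scale_measure (ennreal \<bar>det C\<bar>) (distr lborel borel ((*v) C)) = lborel"
proof (rule lborel_eqI[symmetric])
  have [measurable]: "(*v) C \<in> borel_measurable borel"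
    by (intro borel_measurable_continuous_onI linear_continuous_on matrix_vector_mul_bounded_linear)
  fix l u :: "real^2" assume le: "\<And>b. b \<in> Basis \<Longrightarrow> l \<bullet> b \<le> u \<bullet> b"
  have "emeasure (scale_measure (ennreal \<bar>det C\<bar>) (distr lborel borel ((*v) C))) (box l u) =
      ennreal \<bar>det C\<bar> * emeasure lborel ((*v) C -` box l u)"
    by (simp add: emeasure_distr)
  also have "\<dots> = emeasure lborel (box l u)" by (rule emeasure_matrix_preimage[OF assms])
  finally show "emeasure (scale_measure (ennreal \<bar>det C\<bar>) (distr lborel borel ((*v) C))) (box l u) =
      (\<Prod>b\<in>Basis. (u - l) \<bullet> b)" using le by simp
qed simp

lemma plane_lborel_isometry:
  fixes Q :: "real^2^3" and C :: "real^2^2"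
  assumes "transpose Q ** Q = mat 1" and "invertible C" and "B = Q ** C"
  shows "plane_lborel c B = distr lborel borel (\<lambda>u. c + Q *v u)"
proof -
  have mC: "(*v) C \<in> borel_measurable borel"
    by (intro borel_measurable_continuous_onI linear_continuous_on matrix_vector_mul_bounded_linear)
  have mQ: "(\<lambda>u. c + Q *v u) \<in> borel_measurable borel"
    by (intro borel_measurable_continuous_onI continuous_intros linear_continuous_on matrix_vector_mul_bounded_linear)
  have "transpose B ** B = transpose C ** (transpose Q ** Q) ** C"
    by (simp add: assms(3) matrix_transpose_mul matrix_mul_assoc)
  then have "det (transpose B ** B) = (det C)\<^sup>2"
    by (simp add: assms(1) det_mul power2_eq_square)
  then have s: "sqrt (det (transpose B ** B)) = \<bar>det C\<bar>" by simp
  let ?C = "distr lborel borel ((*v) C)"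
  have d: "distr lborel borel (\<lambda>u. c + B *v u) = distr ?C borel (\<lambda>u. c + Q *v u)"
    using mC mQ by (subst distr_distr) (auto simp: assms(3) o_def matrix_vector_mul_assoc)
  have "plane_lborel c B = scale_measure (ennreal \<bar>det C\<bar>) (distr ?C borel (\<lambda>u. c + Q *v u))"
    unfolding plane_lborel_def s d ..
  also have "\<dots> = distr (scale_measure (ennreal \<bar>det C\<bar>) ?C) borel (\<lambda>u. c + Q *v u)" (is "?L = ?R")
  proof (rule measure_eqI)
    fix A assume "A \<in> sets ?L"
    then have A: "A \<in> sets borel" by simp
    have m: "(\<lambda>u. c + Q *v u) \<in> measurable ?C borel"
        "(\<lambda>u. c + Q *v u) \<in> measurable (scale_measure (ennreal \<bar>det C\<bar>) ?C) borel"
      using mQ by (auto simp: measurable_def space_scale_measure)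
    show "emeasure ?L A = emeasure ?R A"
      by (simp only: emeasure_scale_measure emeasure_distr[OF m(1) A] emeasure_distr[OF m(2) A]
          space_scale_measure)
  qed simp
  finally show ?thesis by (simp add: lborel_matrix[OF assms(2)])
qed

text \<open>The density, with respect to two-dimensional Lebesgue measure, of a random vector
  with values in \<open>affine_plane c B\<close>. It is determined up to a null set of the plane, which does
  not affect integrals; \<open>RN_deriv\<close> is the zero function if there is no density at all.\<close>

definition plane_density ::
  "'w measure \<Rightarrow> real^3 \<Rightarrow> real^2^3 \<Rightarrow> ('w \<Rightarrow> real^3) \<Rightarrow> real^3 \<Rightarrow> real"
where
  "plane_density M c B X y = enn2real (RN_deriv (plane_lborel c B) (distr M borel X) y)"

end

theory Submission
  imports Defs
begin

text \<open>If \<open>0\<close> were outside the hull of the perturbed wrenches, some linear functional \<open>a\<close> would be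
  positive on all of them. At the mean wrench minimizing \<open>a\<close> over \<open>C nbar\<close>, however, a perturbation
  in \<open>- C nbar\<close> lowers the value of \<open>a\<close> by at least that minimum. The remaining claims of (a) are
  Fubini's theorem and monotonicity of integrals of the product density. For (b), the set of
  admissible displacements is convex, so it suffices to check the points \<open>v\<close>, and these are
  admissible because the optimum of each linear program is attained.\<close>

section \<open>Convex hulls containing the origin\<close>

text \<open>Only directions in \<open>D\<close> are tested; with a countable \<open>D\<close> this makes \<open>0 \<in> convex hull X\<close> a
  measurable condition on the points of \<open>X\<close>.\<close>

lemma zero_in_convex_hull_iff_dense:
  fixes X D :: "'a::euclidean_space set"
  assumes "finite X"
    and D: "\<And>U. open U \<Longrightarrow> U \<noteq> {} \<Longrightarrow> \<exists>d\<in>D. d \<in> U"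
  shows "0 \<in> convex hull X \<longleftrightarrow> (\<forall>a\<in>D. \<exists>w\<in>X. a \<bullet> w \<le> 0)"
proof
  assume 0: "0 \<in> convex hull X"
  show "\<forall>a\<in>D. \<exists>w\<in>X. a \<bullet> w \<le> 0"
  proof (rule ccontr)
    assume "\<not> ?thesis"
    then obtain a where a: "\<forall>w\<in>X. a \<bullet> w > 0" by (auto simp: not_le)
    have "convex hull X \<subseteq> {w. a \<bullet> w > 0}"
      using a by (intro hull_minimal convex_halfspace_gt) auto
    with 0 show False by auto
  qed
next
  assume R: "\<forall>a\<in>D. \<exists>w\<in>X. a \<bullet> w \<le> 0"
  show "0 \<in> convex hull X"
  proof (rule ccontr)
    assume "0 \<notin> convex hull X"
    then obtain a b where ab: "0 < b" "\<And>w. w \<in> convex hull X \<Longrightarrow> a \<bullet> w > b"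
      using separating_hyperplane_closed_0[of "convex hull X"] assms(1)
      by (metis convex_convex_hull compact_convex_hull compact_imp_closed finite_imp_compact)
    \<comment> \<open>Positivity on the finite set \<open>X\<close> is an open condition on the
      direction, so the strictly separating \<open>a\<close> can be replaced by an element of
      \<open>D\<close>.\<close>
    let ?U = "\<Inter>w\<in>X. {c. c \<bullet> w > 0}"
    have "open ?U"
      using assms(1) by (intro open_INT) (auto simp: inner_commute open_halfspace_gt)
    moreover have "a \<in> ?U"
      using ab by (force intro: hull_inc)
    ultimately obtain d where "d \<in> D" "d \<in> ?U" using D by blast
    with R show False by force
  qed
qed

text \<open>The deterministic core of (a): \<open>k\<close> stands for a pair of finger and edge,
  \<open>w k\<close> for a mean wrench and \<open>e k\<close> for its change under the random
  normal. For each functional, a single index already violates positivity.\<close>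

lemma zero_in_convex_hull_perturb:
  fixes w e :: "'k::finite \<Rightarrow> 'a::euclidean_space"
  assumes "\<And>k. e k \<in> uminus ` (convex hull range w)"
  shows "0 \<in> convex hull range (\<lambda>k. w k + e k)"
proof -
  have "\<exists>v\<in>range (\<lambda>k. w k + e k). a \<bullet> v \<le> 0" for a
  proof -
    define m where "m = Min (range (\<lambda>k. a \<bullet> w k))"
    have "m \<in> range (\<lambda>k. a \<bullet> w k)" unfolding m_def by (intro Min_in) auto
    then obtain k where k: "m = a \<bullet> w k" by auto
    have "convex hull range w \<subseteq> {v. a \<bullet> v \<ge> m}"
      by (intro hull_minimal convex_halfspace_ge) (auto simp: m_def)
    moreover obtain v where "v \<in> convex hull range w" "e k = - v"
      using assms[of k] by auto
    ultimately have "a \<bullet> (w k + e k) \<le> 0"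
      by (auto simp: inner_diff_right k)
    then show ?thesis by blast
  qed
  then show ?thesis
    by (subst zero_in_convex_hull_iff_dense[where D = UNIV]) auto
qed

section \<open>Sigma-finiteness under completion, scaling and images\<close>

lemma sigma_finite_measure_completion:
  assumes "sigma_finite_measure M"
  shows "sigma_finite_measure (completion M)"
proof -
  interpret sigma_finite_measure M by fact
  obtain A where A: "countable A" "A \<subseteq> sets M" "\<Union>A = space M" "\<forall>a\<in>A. emeasure M a \<noteq> \<infinity>"
    using sigma_finite_countable by blast
  have "\<forall>a\<in>A. emeasure (completion M) a \<noteq> \<infinity>"
    using A by (metis emeasure_completion main_part sets_completionI_sets subsetD)
  with A show ?thesis
    by (intro sigma_finite_measure.intro exI[of _ A]) auto
qed

lemma sigma_finite_measure_scale_measure: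
  assumes "sigma_finite_measure M" "r \<noteq> \<infinity>"
  shows "sigma_finite_measure (scale_measure r M)"
proof -
  interpret sigma_finite_measure M by fact
  obtain A where A: "countable A" "A \<subseteq> sets M" "\<Union>A = space M" "\<forall>a\<in>A. emeasure M a \<noteq> \<infinity>"
    using sigma_finite_countable by blast
  with assms(2) show ?thesis
    by (intro sigma_finite_measure.intro exI[of _ A])
      (auto simp: space_scale_measure ennreal_mult_eq_top_iff)
qed

text \<open>An image of a sigma-finite measure can fail to be sigma-finite. Here injectivity gives
  the image of a ball the measure of the ball itself, and the complement of the range, measurable
  because the range is closed, has measure zero.\<close>

lemma sigma_finite_measure_distr_lborel:
  fixes f :: "'a::euclidean_space \<Rightarrow> 'b::euclidean_space"
  assumes f: "continuous_on UNIV f" and "inj f" and "closed (range f)"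
  shows "sigma_finite_measure (distr lborel borel f)"
proof -
  have [measurable]: "f \<in> borel_measurable borel"
    using f by (rule borel_measurable_continuous_onI)
  define A where "A = insert (- range f) (range (\<lambda>k::nat. f ` cball 0 (real k)))"
  have 1: "f ` cball 0 (real k) \<in> sets borel" for k
    by (intro borel_closed compact_imp_closed compact_continuous_image continuous_on_subset[OF f]) auto
  have 2: "- range f \<in> sets borel" using assms(3) by auto
  have "f -` f ` cball 0 r = cball 0 r" for r
    using \<open>inj f\<close> by (simp add: inj_vimage_image_eq)
  then have "emeasure (distr lborel borel f) (f ` cball 0 (real k)) \<noteq> \<infinity>" for k
    using 1[of k] less_imp_neq[OF emeasure_lborel_cball_finite[of "0::'a" "real k"]]
    by (simp add: emeasure_distr)
  moreover have "f -` (- range f) = {}" by auto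
  then have "emeasure (distr lborel borel f) (- range f) \<noteq> \<infinity>"
    using 2 by (simp add: emeasure_distr)
  moreover have "\<Union>A = UNIV"
  proof -
    have "\<exists>k::nat. u \<in> cball 0 (real k)" for u :: 'a
      using real_arch_simple[of "norm u"] by auto
    then show ?thesis unfolding A_def by fastforce
  qed
  ultimately show ?thesis
    using 1 2 by (intro sigma_finite_measure.intro exI[of _ A]) (auto simp: A_def)
qed

section \<open>Lebesgue measure on an affine plane\<close>

lemma inj_matrix_vector_mult_of_independent_columns:
  fixes A :: "real^'n^'m"
  assumes "inj (\<lambda>k. column k A)" "independent (columns A)"
  shows "inj ((*v) A)"
proof -
  have "columns A = range (\<lambda>k. column k A)" by (auto simp: columns_def)
  then have "card (columns A) = CARD('n)" using assms(1) by (simp add: card_image)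
  then show ?thesis
    using assms(2) by (simp add: full_rank_injective[symmetric] column_rank_def dim_eq_card_independent)
qed

text \<open>Keeps the scale factor of \<open>plane_lborel\<close> from vanishing. Since
  \<open>u\<close> paired with its image under the Gram matrix is the squared norm of
  \<open>B *v u\<close>, injectivity makes the Gram matrix nonsingular.\<close>

lemma det_gram_pos:
  fixes B :: "real^2^3"
  assumes "inj ((*v) B)"
  shows "det (transpose B ** B) > 0"
proof -
  let ?G = "transpose B ** B"
  have "?G *v u = 0 \<Longrightarrow> u = 0" for u
  proof -
    assume "?G *v u = 0"
    then have "(B *v u) \<bullet> (B *v u) = 0"
      by (simp add: dot_lmul_matrix[symmetric] matrix_vector_mul_assoc[symmetric]
          flip: transpose_matrix_vector) 
    then have "B *v u = B *v 0" by simp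
    with assms show "u = 0" by (rule injD)
  qed
  then have "invertible ?G"
    by (meson invertible_left_inverse matrix_left_invertible_ker)
  then have "det ?G \<noteq> 0" by (simp add: invertible_det_nz)
  \<comment> \<open>Lagrange's identity, for the sign\<close>
  moreover have "det ?G = (B$1$1 * B$2$2 - B$1$2 * B$2$1)\<^sup>2 + (B$1$1 * B$3$2 - B$1$2 * B$3$1)\<^sup>2
      + (B$2$1 * B$3$2 - B$2$2 * B$3$1)\<^sup>2"
    by (simp add: det_2 matrix_matrix_mult_def transpose_def sum_3 power2_eq_square algebra_simps)
  ultimately show ?thesis
    by (smt (verit) zero_le_power2)
qed

lemma continuous_on_affine_plane_map: "continuous_on X (\<lambda>u. c + B *v u)" for B :: "real^'n^'m"
  by (intro continuous_intros linear_continuous_on matrix_vector_mul_bounded_linear)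

lemma closed_affine_plane: "closed (affine_plane c B)"
proof -
  have "affine_plane c B = (+) c ` range ((*v) B)"
    by (auto simp: affine_plane_def)
  moreover have "subspace (range ((*v) B))"
    by (intro linear_subspace_image subspace_UNIV matrix_vector_mul_linear)
  ultimately show ?thesis by (simp add: closed_translation closed_subspace)
qed

lemma sets_plane_lborel [measurable_cong]: "sets (plane_lborel c B) = sets borel"
  by (simp add: plane_lborel_def)

lemma space_plane_lborel: "space (plane_lborel c B) = UNIV"
  by (simp add: plane_lborel_def space_scale_measure)

lemma sigma_finite_plane_lborel:
  assumes "inj ((*v) B)"
  shows "sigma_finite_measure (plane_lborel c B)"
  unfolding plane_lborel_def
proof (intro sigma_finite_measure_scale_measure sigma_finite_measure_distr_lborel
    continuous_on_affine_plane_map)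
  show "inj (\<lambda>u. c + B *v u)" using assms by (auto simp: inj_def)
  have "range (\<lambda>u. c + B *v u) = affine_plane c B" by (auto simp: affine_plane_def)
  then show "closed (range (\<lambda>u. c + B *v u))" by (simp add: closed_affine_plane)
qed simp

text \<open>A null set of the plane pulls back to a Lebesgue null set of parameters, which the noise
  \<open>E\<close> hits with probability zero because it has a density. This makes the Radon-Nikodym
  derivative in \<open>plane_density\<close> meaningful.\<close>

lemma absolutely_continuous_plane_lborel:
  assumes B: "inj ((*v) B)"
    and d: "distributed M lborel E f"
    and X: "\<And>\<omega>. \<omega> \<in> space M \<Longrightarrow> X \<omega> = c + B *v E \<omega>"
  shows "absolutely_continuous (plane_lborel c B) (distr M borel X)"
  unfolding absolutely_continuous_def
proof
  have m: "(\<lambda>u. c + B *v u) \<in> borel_measurable borel"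
    by (intro borel_measurable_continuous_onI continuous_on_affine_plane_map)
  have E: "E \<in> M \<rightarrow>\<^sub>M lborel" using d by (simp add: distributed_def)
  then have E': "E \<in> borel_measurable M" by simp
  have "(\<lambda>\<omega>. c + B *v E \<omega>) \<in> borel_measurable M"
    using measurable_compose[OF E' m] .
  then have X': "X \<in> borel_measurable M" using X by (simp cong: measurable_cong)
  fix A assume A: "A \<in> null_sets (plane_lborel c B)"
  then have Ab: "A \<in> sets borel" by (auto simp: sets_plane_lborel)
  let ?V = "(\<lambda>u. c + B *v u) -` A"
  \<comment> \<open>The scale factor is positive, so it drops out of the condition of being
    null.\<close>
  have "emeasure (distr lborel borel (\<lambda>u. c + B *v u)) A = 0"
    using A det_gram_pos[OF B] by (auto simp: plane_lborel_def null_sets_def)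
  then have V: "?V \<in> null_sets lborel"
    using Ab measurable_sets[OF m, of A] m by (auto simp: null_sets_def emeasure_distr)
  have "distr M lborel E = density lborel f" "f \<in> borel_measurable lborel"
    using d by (auto simp: distributed_def)
  then have "?V \<in> null_sets (distr M lborel E)"
    using absolutely_continuousI_density V unfolding absolutely_continuous_def
    by (metis (full_types) subsetD)
  then have "E -` ?V \<inter> space M \<in> null_sets M"
    using E by (simp add: null_sets_distr_iff)
  moreover have "E -` ?V \<inter> space M = X -` A \<inter> space M" using X by auto
  ultimately show "A \<in> null_sets (distr M borel X)"
    using X' Ab by (simp add: null_sets_distr_iff)
qed

section \<open>Products of completed measures\<close>

text \<open>The integrals of the theorem run over a product of completions, while the joint law of
  the normals lives on the Borel product; the identity map connects the two. Measurability is
  checked coordinatewise, where completion only adds measurable sets.\<close>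

lemma measurable_ident_PiM_completion:
  "(\<lambda>y. y) \<in> PiM I (\<lambda>i. completion (L i)) \<rightarrow>\<^sub>M PiM I L"
proof -
  have comp: "(\<lambda>y. y i) \<in> PiM I (\<lambda>i. completion (L i)) \<rightarrow>\<^sub>M L i" if "i \<in> I" for i
    using measurable_component_singleton[OF that, of "\<lambda>i. completion (L i)"]
    by (auto simp: measurable_def)
  have "(\<lambda>y i. y i) \<in> PiM I (\<lambda>i. completion (L i)) \<rightarrow>\<^sub>M PiM I L"
    by (rule measurable_PiM_single') (auto simp: comp space_PiM)
  then show ?thesis by simp
qed

lemma sets_PiM_completion:
  assumes "E \<in> sets (PiM I L)"
  shows "E \<in> sets (PiM I (\<lambda>i. completion (L i)))"
  using measurable_sets[OF measurable_ident_PiM_completion assms] sets.sets_into_space[OF assms]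
  by (simp add: space_PiM Int_absorb2)

text \<open>The product of completions carries a finer \<open>\<sigma>\<close>-algebra than the product of the densities,
  hence the restriction to sets measurable before completion.\<close>

lemma emeasure_PiM_density_completion:
  fixes f :: "'i \<Rightarrow> 'a \<Rightarrow> ennreal"
  assumes I: "finite I"
    and L: "\<And>i. sigma_finite_measure (L i)"
    and f [measurable]: "\<And>i. f i \<in> borel_measurable (L i)"
    and D: "\<And>i. sigma_finite_measure (density (L i) (f i))"
    and E: "E \<in> sets (PiM I L)"
  shows "emeasure (PiM I (\<lambda>i. density (L i) (f i))) E =
    (\<integral>\<^sup>+y. (\<Prod>i\<in>I. f i (y i)) * indicator E y \<partial>PiM I (\<lambda>i. completion (L i)))"
proof -
  interpret K: product_sigma_finite "\<lambda>i. completion (L i)"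
    by (intro product_sigma_finite.intro sigma_finite_measure_completion L)
  interpret D: product_sigma_finite "\<lambda>i. density (L i) (f i)"
    by (intro product_sigma_finite.intro D)
  let ?K = "PiM I (\<lambda>i. completion (L i))"
  let ?p = "\<lambda>y. \<Prod>i\<in>I. f i (y i)"
  have f' [measurable]: "f i \<in> borel_measurable (completion (L i))" for i
    by (intro measurable_completion f)
  have p [measurable]: "?p \<in> borel_measurable ?K" by measurable
  note id = measurable_ident_PiM_completion[of I L]
  note sub = sets_PiM_completion[of _ I L]
  \<comment> \<open>The image under the identity restricts the measure to the coarser product
    algebra, where agreement on boxes determines a product measure.\<close>
  let ?Q = "distr (density ?K ?p) (PiM I L) (\<lambda>y. y)"
  have Q: "emeasure ?Q F = (\<integral>\<^sup>+y. ?p y * indicator F y \<partial>?K)" if F: "F \<in> sets (PiM I L)" for F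
  proof -
    have "F \<subseteq> space ?K" using sets.sets_into_space[OF F] by (simp add: space_PiM)
    with sub[OF F] F id show ?thesis
      by (simp add: emeasure_distr emeasure_density Int_absorb2)
  qed
  have "?Q = PiM I (\<lambda>i. density (L i) (f i))"
  proof (rule D.PiM_eqI[OF I])
    show "sets ?Q = sets (PiM I (\<lambda>i. density (L i) (f i)))"
      by (simp cong: sets_PiM_cong)
    fix A assume "\<And>i. i \<in> I \<Longrightarrow> A i \<in> sets (density (L i) (f i))"
    then have A: "\<And>i. i \<in> I \<Longrightarrow> A i \<in> sets (L i)" by simp
    have "emeasure ?Q (Pi\<^sub>E I A) = (\<integral>\<^sup>+y. ?p y * indicator (Pi\<^sub>E I A) y \<partial>?K)"
      by (intro Q sets_PiM_I_finite I A)
    also have "\<dots> = (\<integral>\<^sup>+y. (\<Prod>i\<in>I. f i (y i) * indicator (A i) (y i)) \<partial>?K)"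
    proof (rule nn_integral_cong)
      fix y assume "y \<in> space ?K"
      then have "indicator (Pi\<^sub>E I A) y = (\<Prod>i\<in>I. indicator (A i) (y i) :: ennreal)"
        using I by (auto simp: indicator_def space_PiM PiE_iff)
      then show "?p y * indicator (Pi\<^sub>E I A) y = (\<Prod>i\<in>I. f i (y i) * indicator (A i) (y i))"
        by (simp add: prod.distrib)
    qed
    also have "\<dots> = (\<Prod>i\<in>I. \<integral>\<^sup>+y. f i y * indicator (A i) y \<partial>completion (L i))"
      using A
      by (intro K.product_nn_integral_prod I borel_measurable_times_ennreal f'
          borel_measurable_indicator sets_completionI_sets)
    also have "\<dots> = (\<Prod>i\<in>I. emeasure (density (L i) (f i)) (A i))"
      using A by (intro prod.cong refl) (simp add: nn_integral_completion emeasure_density)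
    finally show "emeasure ?Q (Pi\<^sub>E I A) = (\<Prod>i\<in>I. emeasure (density (L i) (f i)) (A i))" .
  qed
  with Q[OF E] show ?thesis by simp
qed


section \<open>Wrench hulls and the linear programs\<close>

lemma stack_mult_Inl: "(stack A B *v v) $ Inl a = (A *v v) $ a"
  by (simp add: stack_def matrix_vector_mult_def)

text \<open>The three force rows suffice: their block is the identity plus a skew matrix, and the
  skew part vanishes in the quadratic form, leaving \<open>v \<bullet> v = 0\<close>.\<close>

lemma wrench_matrix_mult_eq_0:
  assumes "wrench_matrix \<mu> x g *v v = 0"
  shows "v = 0"
proof -
  have "(mat 1 + \<mu> *\<^sub>R skew g) *v v = 0"
  proof (subst vec_eq_iff, intro allI)
    fix a
    have "((mat 1 + \<mu> *\<^sub>R skew g) *v v) $ a = (wrench_matrix \<mu> x g *v v) $ Inl a"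
      by (simp only: wrench_matrix_def stack_mult_Inl)
    then show "((mat 1 + \<mu> *\<^sub>R skew g) *v v) $ a = 0 $ a" using assms by simp
  qed
  then have "v + \<mu> *\<^sub>R cross3 g v = 0"
    by (simp add: matrix_vector_mult_add_rdistrib scaleR_matrix_vector_assoc[symmetric] skew_mult)
  then have "v \<bullet> (v + \<mu> *\<^sub>R cross3 g v) = 0" by simp
  then show ?thesis by (simp add: inner_add_right dot_cross_self)
qed

text \<open>Reindexing by pairs, the column index of \<open>basis_wrench_columns\<close>, makes the
  facts about one finite family applicable.\<close>

lemma wrench_hull_eq:
  "wrench_hull \<mu> x g n = convex hull range (\<lambda>p. basis_wrench \<mu> x g n (fst p) (snd p))"
proof -
  have "{basis_wrench \<mu> x g n i j | i j. True} = range (\<lambda>p. basis_wrench \<mu> x g n (fst p) (snd p))"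
    (is "?L = range ?w")
  proof (intro set_eqI iffI)
    fix v assume "v \<in> ?L"
    then obtain i j where "v = basis_wrench \<mu> x g n i j" by blast
    then show "v \<in> range ?w" by (intro image_eqI[of _ _ "(i, j)"]) auto
  qed blast
  then show ?thesis by (simp add: wrench_hull_def)
qed

lemma compact_wrench_hull:
  fixes g :: "'f::finite \<Rightarrow> 's::finite \<Rightarrow> real^3"
  shows "compact (wrench_hull \<mu> x g n)"
  unfolding wrench_hull_eq by (intro compact_convex_hull finite_imp_compact) simp

lemma convex_wrench_hull: "convex (wrench_hull \<mu> x g n)"
  by (simp add: wrench_hull_def)

lemma zero_in_wrench_hull:
  fixes g :: "'f::finite \<Rightarrow> 's::finite \<Rightarrow> real^3"
  assumes "\<And>i j. wrench_matrix \<mu> (x i) (g i j) *v (y i - n i) \<in> uminus ` wrench_hull \<mu> x g n"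
  shows "0 \<in> wrench_hull \<mu> x g y"
proof -
  let ?w = "\<lambda>n p. basis_wrench \<mu> x g n (fst p) (snd p)"
  let ?e = "\<lambda>p. wrench_matrix \<mu> (x (fst p)) (g (fst p) (snd p)) *v (y (fst p) - n (fst p))"
  have 0: "0 \<in> convex hull range (\<lambda>p. ?w n p + ?e p)"
    using assms by (intro zero_in_convex_hull_perturb) (simp add: wrench_hull_eq)
  \<comment> \<open>The wrench matrices are the same for both normals, so linearity turns the
    perturbed mean wrench into the wrench of \<open>y\<close>.\<close>
  have "(\<lambda>p. ?w n p + ?e p) = ?w y"
    by (simp add: basis_wrench_def matrix_vector_mult_diff_distrib)
  from 0[unfolded this] show ?thesis unfolding wrench_hull_eq .
qed

text \<open>Gives the measurability of the force closure region. With a countable dense set of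
  directions the condition is a countable intersection of finite unions of half-space conditions,
  each continuous in one normal.\<close>

lemma sets_zero_in_wrench_hull:
  fixes g :: "'f::finite \<Rightarrow> 's::finite \<Rightarrow> real^3"
  shows "{y. 0 \<in> wrench_hull \<mu> x g y} \<in> sets (PiM UNIV (\<lambda>_. borel))"
proof -
  obtain D :: "(real^(3+3)) set" where D: "countable D"
    "\<And>U. open U \<Longrightarrow> U \<noteq> {} \<Longrightarrow> \<exists>d\<in>D. d \<in> U"
    by (rule countable_dense_setE) blast
  let ?w = "\<lambda>p y. basis_wrench \<mu> x g y (fst p) (snd p)"
  have w: "(\<lambda>y. a \<bullet> ?w p y) \<in> borel_measurable (PiM UNIV (\<lambda>_. borel))" for a p
  proof -
    have "continuous_on UNIV (\<lambda>v. a \<bullet> (wrench_matrix \<mu> (x (fst p)) (g (fst p) (snd p)) *v v))"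
      by (intro continuous_intros linear_continuous_on matrix_vector_mul_bounded_linear)
    then show ?thesis
      unfolding basis_wrench_def
      by (intro measurable_compose[OF measurable_component_singleton[of "fst p" UNIV "\<lambda>_. borel"]]
          borel_measurable_continuous_onI) auto
  qed
  have "{y. 0 \<in> wrench_hull \<mu> x g y} = (\<Inter>a\<in>D. \<Union>p. {y \<in> space (PiM UNIV (\<lambda>_. borel)). a \<bullet> ?w p y \<le> 0})"
    using zero_in_convex_hull_iff_dense[OF _ D(2)]
    by (auto simp: wrench_hull_eq space_PiM)
  also have "\<dots> \<in> sets (PiM UNIV (\<lambda>_. borel))"
  proof (rule sets.countable_INT''[OF _ D(1)])
    show "UNIV \<in> sets (PiM UNIV (\<lambda>_. borel))"
      using sets.top[of "PiM UNIV (\<lambda>_. borel)"] by (simp add: space_PiM)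
    show "(\<Union>p. {y \<in> space (PiM UNIV (\<lambda>_. borel)). a \<bullet> ?w p y \<le> 0}) \<in> sets (PiM UNIV (\<lambda>_. borel))" for a
      by (intro sets.finite_UN borel_measurable_le w borel_measurable_const) auto
  qed
  finally show ?thesis .
qed

text \<open>The constraints make \<open>\<alpha> j\<close> a vector of convex weights, so the matrix
  product is a convex combination of the mean wrenches.\<close>

lemma vlp_feasible_wrench_hull:
  assumes "vlp_feasible \<mu> x g n i d \<theta> \<alpha>"
  shows "wrench_matrix \<mu> (x i) (g i j) *v (\<theta> *\<^sub>R d) \<in> uminus ` wrench_hull \<mu> x g n"
proof -
  have "basis_wrench_columns \<mu> x g n *v \<alpha> j =
      (\<Sum>p\<in>UNIV. (\<alpha> j $ p) *\<^sub>R basis_wrench \<mu> x g n (fst p) (snd p))"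
    by (simp add: vec_eq_iff matrix_vector_mult_def basis_wrench_columns_def mult.commute)
  also have "\<dots> \<in> wrench_hull \<mu> x g n"
    using assms unfolding vlp_feasible_def wrench_hull_eq
    by (intro convex_sum) (auto intro: hull_inc)
  finally show ?thesis using assms unfolding vlp_feasible_def by blast
qed

text \<open>Injectivity of the wrench matrices bounds the feasible values, so the supremum is attained.\<close>

lemma vlp_value_wrench_hull:
  fixes g :: "'f::finite \<Rightarrow> 's::finite \<Rightarrow> real^3"
  assumes "d \<noteq> 0" and feas: "\<exists>\<theta> \<alpha>. vlp_feasible \<mu> x g n i d \<theta> \<alpha>"
  shows "wrench_matrix \<mu> (x i) (g i j) *v (vlp_value \<mu> x g n i d *\<^sub>R d)
    \<in> uminus ` wrench_hull \<mu> x g n"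
proof -
  let ?T = "wrench_matrix \<mu> (x i) (g i j)"
  let ?C = "uminus ` wrench_hull \<mu> x g n"
  let ?F = "{\<theta>. \<exists>\<alpha>. vlp_feasible \<mu> x g n i d \<theta> \<alpha>}"
  have C: "compact ?C" by (intro compact_negations compact_wrench_hull)
  have F: "?T *v (\<theta> *\<^sub>R d) \<in> ?C" if "\<theta> \<in> ?F" for \<theta>
    using that vlp_feasible_wrench_hull by blast
  obtain b where b: "\<And>v. v \<in> ?C \<Longrightarrow> norm v \<le> b"
    using compact_imp_bounded[OF C] by (meson bounded_iff)
  have pos: "norm (?T *v d) > 0"
    using wrench_matrix_mult_eq_0 \<open>d \<noteq> 0\<close> by auto
  have "\<theta> \<le> b / norm (?T *v d)" if "\<theta> \<in> ?F" for \<theta>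
  proof -
    have "\<bar>\<theta>\<bar> * norm (?T *v d) \<le> b"
      using b[OF F[OF that]] by (simp add: matrix_vector_mult_scaleR)
    then have "\<bar>\<theta>\<bar> \<le> b / norm (?T *v d)" using pos by (simp add: pos_le_divide_eq)
    then show ?thesis by linarith
  qed
  \<comment> \<open>Together with nonemptiness this makes \<open>Sup ?F\<close> a genuine supremum.
    \<open>?F\<close> lies in the closed set of all \<open>\<theta>\<close> admissible for the one
    edge \<open>j\<close>, hence so does its supremum.\<close>
  then have "bdd_above ?F" by (auto simp: bdd_above_def)
  moreover have "closed ((\<lambda>\<theta>. ?T *v (\<theta> *\<^sub>R d)) -` ?C)"
  proof (rule closed_vimage[OF compact_imp_closed[OF C]])
    show "continuous_on UNIV (\<lambda>\<theta>. ?T *v (\<theta> *\<^sub>R d))"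
      unfolding matrix_vector_mult_scaleR by (intro continuous_intros)
  qed
  moreover have "?F \<subseteq> (\<lambda>\<theta>. ?T *v (\<theta> *\<^sub>R d)) -` ?C" using F by blast
  moreover have "?F \<noteq> {}" using feas by blast
  ultimately have "Sup ?F \<in> (\<lambda>\<theta>. ?T *v (\<theta> *\<^sub>R d)) -` ?C"
    by (intro closed_subset_contains_Sup)
  then show ?thesis by (simp add: vlp_value_def)
qed

section \<open>The law of a random normal\<close>

text \<open>Absolute continuity lets the Radon-Nikodym derivative reproduce the law. The law is a
  probability measure, so the derivative is finite almost everywhere and its conversion to a real
  value changes it only on a null set.\<close>

lemma distr_eq_density_plane_density:
  assumes M: "prob_space M" and B: "inj ((*v) B)"
    and d: "distributed M lborel E f"
    and X: "\<And>\<omega>. \<omega> \<in> space M \<Longrightarrow> X \<omega> = c + B *v E \<omega>"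
    and Xm: "X \<in> borel_measurable M"
  shows "density (plane_lborel c B) (\<lambda>y. ennreal (plane_density M c B X y)) = distr M borel X"
proof -
  let ?L = "plane_lborel c B"
  interpret M: prob_space M by fact
  interpret D: prob_space "distr M borel X" by (rule M.prob_space_distr[OF Xm])
  interpret L: sigma_finite_measure ?L by (rule sigma_finite_plane_lborel[OF B])
  have ac: "absolutely_continuous ?L (distr M borel X)"
    by (rule absolutely_continuous_plane_lborel[OF B d X])
  have s: "sets (distr M borel X) = sets ?L" by (simp add: sets_plane_lborel)
  have "AE y in ?L. RN_deriv ?L (distr M borel X) y \<noteq> \<infinity>"
    by (rule L.RN_deriv_finite[OF D.sigma_finite_measure_axioms ac s])
  then have "AE y in ?L. ennreal (plane_density M c B X y) = RN_deriv ?L (distr M borel X) y"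
    by eventually_elim (simp add: plane_density_def less_top)
  then have "density ?L (\<lambda>y. ennreal (plane_density M c B X y)) = density ?L (RN_deriv ?L (distr M borel X))"
    by (intro density_cong) (auto simp: plane_density_def)
  then show ?thesis using L.density_RN_deriv[OF ac s] by simp
qed


section \<open>Probability bound and the polytopes from the linear programs\<close>

theorem mainTheorem1:
  fixes M :: "'w measure"
    and x nbar :: "'f::finite \<Rightarrow> real^3"
    and g :: "'f \<Rightarrow> 's::finite \<Rightarrow> real^3"
    and \<mu> :: real
    and B :: "'f \<Rightarrow> real^2^3"
    and S :: "'f \<Rightarrow> real^2^2"
    and \<epsilon> :: "'f \<Rightarrow> 'w \<Rightarrow> real^2"
    and n :: "'f \<Rightarrow> 'w \<Rightarrow> real^3"
  defines "P \<equiv> \<lambda>i. affine_plane (nbar i) (B i)"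
    and "dn \<equiv> \<lambda>i. plane_lebesgue (nbar i) (B i)"
    and "p \<equiv> \<lambda>i. plane_density M (nbar i) (B i) (n i)"
    and "T \<equiv> \<lambda>i j. wrench_matrix \<mu> (x i) (g i j)"
    and "C \<equiv> wrench_hull \<mu> x g"
  defines "N \<equiv> {y \<in> (\<Pi>\<^sub>E i\<in>UNIV. P i). 0 \<in> C y}"
    and "admissible \<equiv> \<lambda>i. {y \<in> P i. \<forall>j. T i j *v (y - nbar i) \<in> uminus ` C nbar}"
    and "P_fc \<equiv> measure M {\<omega> \<in> space M. 0 \<in> C (\<lambda>i. n i \<omega>)}"
    and "L_fc \<equiv> \<lambda>A. \<Prod>i\<in>UNIV. LINT y:A i|dn i. p i y"
    and "I_fc \<equiv> \<lambda>D. LINT y:D|(\<Pi>\<^sub>M i\<in>UNIV. dn i). \<Prod>i\<in>UNIV. p i (y i)"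
  assumes "\<mu> > 0"
    and "\<And>i. norm (nbar i) = 1"
    and "\<And>i j. norm (g i j) = 1 \<and> g i j \<bullet> nbar i = 0"
    and "\<And>i. inj (\<lambda>k. column k (B i)) \<and> independent (columns (B i)) \<and>
           span (columns (B i)) = {v. v \<bullet> nbar i = 0}"
    and "\<And>i. sym_pos_def (S i)"
    and "prob_space M"
    and "\<And>i. distributed M lborel (\<epsilon> i) (\<lambda>u. ennreal (centered_normal_density (S i) u))"
    and "\<And>i \<omega>. \<omega> \<in> space M \<Longrightarrow> n i \<omega> = nbar i + B i *v \<epsilon> i \<omega>"
    and "prob_space.indep_vars M (\<lambda>_. borel) n UNIV"
  shows "(\<forall>A. (\<forall>i. A i \<in> sets (dn i) \<and> A i \<subseteq> P i \<and> A i \<subseteq> admissible i) \<longrightarrow>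
             (\<Pi>\<^sub>E i\<in>UNIV. A i) \<subseteq> N \<and>
             L_fc A = I_fc (\<Pi>\<^sub>E i\<in>UNIV. A i) \<and>
             I_fc (\<Pi>\<^sub>E i\<in>UNIV. A i) \<le> I_fc N \<and>
             I_fc N = P_fc)
       \<and> (\<forall>(nv::nat) d A.
             (\<forall>i. \<forall>k\<in>{1..nv}. d i k \<in> range ((*v) (B i)) \<and> d i k \<noteq> 0 \<and>
                  (\<exists>\<theta> \<alpha>. vlp_feasible \<mu> x g nbar i (d i k) \<theta> \<alpha>)) \<and>
             (\<forall>i. A i = (+) (nbar i) `
                  (convex hull ((\<lambda>k. vlp_value \<mu> x g nbar i (d i k) *\<^sub>R d i k) ` {1..nv}))) \<longrightarrow>
             (\<forall>i. A i \<in> sets (dn i) \<and> A i \<subseteq> P i \<and> A i \<subseteq> admissible i) \<and>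
             L_fc A \<le> P_fc)"
proof -
  interpret M: prob_space M by fact
  let ?bL = "\<lambda>i. plane_lborel (nbar i) (B i)"
  let ?K = "\<Pi>\<^sub>M i\<in>UNIV. dn i"
  let ?p = "\<lambda>y. \<Prod>i\<in>UNIV. p i (y i)"
  have B: "inj ((*v) (B i))" for i
    using assms(14)[of i] by (intro inj_matrix_vector_mult_of_independent_columns) auto
  have sf: "sigma_finite_measure (?bL i)" for i
    by (rule sigma_finite_plane_lborel[OF B])
  interpret K: product_sigma_finite dn
    unfolding dn_def plane_lebesgue_def
    by (intro product_sigma_finite.intro sigma_finite_measure_completion sf)
  have n: "n i \<in> borel_measurable M" for i
    using assms(19) by (simp add: M.indep_vars_def2)
  have dens: "density (?bL i) (\<lambda>y. ennreal (p i y)) = distr M borel (n i)" for i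
    unfolding p_def
    by (rule distr_eq_density_plane_density[OF assms(16) B assms(17) assms(18) n])
  have p0: "p i y \<ge> 0" for i y by (simp add: p_def plane_density_def)
  have pm: "p i \<in> borel_measurable (?bL i)" for i
    unfolding p_def plane_density_def by measurable
  \<comment> \<open>The density integrates to the total mass 1 of the law, and completion leaves the
    integral of a Borel function unchanged.\<close>
  have p_int: "integrable (dn i) (p i)" for i
  proof -
    interpret D: prob_space "distr M borel (n i)" by (rule M.prob_space_distr[OF n])
    have "(\<integral>\<^sup>+y. ennreal (p i y) \<partial>?bL i) = emeasure (density (?bL i) (\<lambda>y. ennreal (p i y))) UNIV"
      using pm[of i] by (simp add: emeasure_density space_plane_lborel[symmetric])
    also have "\<dots> = 1" unfolding dens using D.emeasure_space_1 by simp
    finally have "integrable (?bL i) (p i)"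
      using pm[of i] p0 by (intro integrableI_nonneg) auto
    then show ?thesis
      using pm[of i] by (simp add: dn_def plane_lebesgue_def integrable_completion)
  qed
  have int: "integrable ?K ?p"
    by (intro K.product_integrable_prod p_int) simp
  have space_dn: "space (dn i) = UNIV" for i
    by (simp add: dn_def plane_lebesgue_def space_plane_lborel)
  have sets_dn: "E \<in> sets borel \<Longrightarrow> E \<in> sets (dn i)" for E i
    by (simp add: dn_def plane_lebesgue_def sets_plane_lborel)
  have P: "P i \<in> sets borel" for i
    unfolding P_def by (intro borel_closed closed_affine_plane)
  \<comment> \<open>\<open>N\<close> is first measurable in the Borel product, as a box of closed
    planes cut by the hull condition, and is then carried over to the product of
    completions.\<close>
  have "N = (\<Pi>\<^sub>E i\<in>UNIV. P i) \<inter> {y. 0 \<in> C y}" by (auto simp: N_def)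
  also have "\<dots> \<in> sets (PiM UNIV (\<lambda>_. borel))"
    unfolding C_def by (intro sets.Int sets_PiM_I_finite P sets_zero_in_wrench_hull) simp
  finally have N: "N \<in> sets (PiM UNIV (\<lambda>_. borel))" .
  have N_L: "N \<in> sets (PiM UNIV ?bL)"
    using N sets_PiM_cong[OF refl, of UNIV ?bL "\<lambda>_. borel"] by (simp add: sets_plane_lborel)
  have N_K: "N \<in> sets ?K"
    using sets_PiM_completion[OF N_L] by (simp add: dn_def plane_lebesgue_def)
  have ennreal_p: "ennreal (?p y) = (\<Prod>i\<in>UNIV. ennreal (p i (y i)))" for y
    using p0 by (simp add: prod_ennreal)
  have mono: "I_fc E \<le> I_fc N" if "E \<subseteq> N" "E \<in> sets ?K" for E
    unfolding I_fc_def set_lebesgue_integral_def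
    using that N_K int p0
    by (intro integral_mono integrable_mult_indicator)
      (auto simp: indicator_def prod_nonneg)
  \<comment> \<open>The integral of the product density over \<open>N\<close> is identified with the
    mass of \<open>N\<close> under the product of the marginal laws, and this in turn with the
    probability of an event in \<open>M\<close>.\<close>
  have IN: "I_fc N = P_fc"
  proof -
    let ?D = "PiM UNIV (\<lambda>i. distr M borel (n i))"
    have "I_fc N = (\<integral>y. ?p y * indicator N y \<partial>?K)"
      by (simp add: I_fc_def set_lebesgue_integral_def mult.commute)
    also have "\<dots> = enn2real (\<integral>\<^sup>+y. ennreal (?p y * indicator N y) \<partial>?K)"
      using int N_K p0
      by (intro integral_eq_nn_integral) (auto simp: prod_nonneg)
    also have "(\<integral>\<^sup>+y. ennreal (?p y * indicator N y) \<partial>?K) =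
        (\<integral>\<^sup>+y. (\<Prod>i\<in>UNIV. ennreal (p i (y i))) * indicator N y \<partial>?K)"
      using p0 by (intro nn_integral_cong) (auto simp: indicator_def ennreal_p[symmetric])
    also have "\<dots> = emeasure (PiM UNIV (\<lambda>i. density (?bL i) (\<lambda>y. ennreal (p i y)))) N"
      unfolding dn_def plane_lebesgue_def
      using pm dens n
      by (intro emeasure_PiM_density_completion[symmetric] sf N_L)
        (auto intro!: prob_space_imp_sigma_finite M.prob_space_distr)
    also have "\<dots> = emeasure ?D N" by (simp add: dens)
    \<comment> \<open>Independence enters here: the product of the marginal laws is the joint law of
      the normals.\<close>
    also have "?D = distr M (PiM UNIV (\<lambda>_. borel)) (\<lambda>\<omega> i. n i \<omega>)"
      using assms(19) n by (subst (asm) M.indep_vars_iff_distr_eq_PiM) (auto simp: restrict_UNIV)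
    also have "emeasure \<dots> N = emeasure M {\<omega> \<in> space M. (\<lambda>i. n i \<omega>) \<in> N}"
      using N n by (subst emeasure_distr)
        (auto intro!: measurable_PiM_single' arg_cong[where f = "emeasure M"])
    \<comment> \<open>Each normal lies in its plane for every outcome, so membership in
      \<open>N\<close> reduces to the hull condition.\<close>
    also have "{\<omega> \<in> space M. (\<lambda>i. n i \<omega>) \<in> N} = {\<omega> \<in> space M. 0 \<in> C (\<lambda>i. n i \<omega>)}"
      using assms(18) by (auto simp: N_def P_def affine_plane_def)
    finally show ?thesis by (simp add: P_fc_def measure_def)
  qed
  have a: "(\<Pi>\<^sub>E i\<in>UNIV. A i) \<subseteq> N \<and> L_fc A = I_fc (\<Pi>\<^sub>E i\<in>UNIV. A i) \<and>
      I_fc (\<Pi>\<^sub>E i\<in>UNIV. A i) \<le> I_fc N \<and> I_fc N = P_fc"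
    if A: "\<And>i. A i \<in> sets (dn i) \<and> A i \<subseteq> P i \<and> A i \<subseteq> admissible i" for A
  proof (intro conjI IN)
    show sub: "(\<Pi>\<^sub>E i\<in>UNIV. A i) \<subseteq> N"
    proof
      fix y assume y: "y \<in> (\<Pi>\<^sub>E i\<in>UNIV. A i)"
      then have adm: "y i \<in> admissible i" and "y i \<in> P i" for i using A[of i] by auto
      have "0 \<in> C y"
        unfolding C_def
      proof (rule zero_in_wrench_hull)
        show "wrench_matrix \<mu> (x i) (g i j) *v (y i - nbar i) \<in> uminus ` wrench_hull \<mu> x g nbar"
          for i j
          using adm[of i] by (simp add: admissible_def T_def C_def)
      qed
      with \<open>\<And>i. y i \<in> P i\<close> show "y \<in> N" by (simp add: N_def PiE_iff)
    qed
    show "I_fc (\<Pi>\<^sub>E i\<in>UNIV. A i) \<le> I_fc N"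
      using A by (intro mono sub sets_PiM_I_finite) auto
    \<comment> \<open>The indicator of a box is the product of the coordinate indicators, so the
      integrand separates and Fubini factors the integral.\<close>
    have "I_fc (\<Pi>\<^sub>E i\<in>UNIV. A i) = (\<integral>y. (\<Prod>i\<in>UNIV. indicator (A i) (y i) * p i (y i)) \<partial>?K)"
      unfolding I_fc_def set_lebesgue_integral_def
    proof (rule Bochner_Integration.integral_cong[OF refl])
      fix y
      have "indicator (\<Pi>\<^sub>E i\<in>UNIV. A i) y = (\<Prod>i\<in>UNIV. indicator (A i) (y i) :: real)"
        by (auto simp: indicator_def PiE_iff)
      then show "indicator (\<Pi>\<^sub>E i\<in>UNIV. A i) y *\<^sub>R ?p y = (\<Prod>i\<in>UNIV. indicator (A i) (y i) * p i (y i))"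
        by (simp add: prod.distrib)
    qed
    also have "\<dots> = (\<Prod>i\<in>UNIV. \<integral>y. indicator (A i) y * p i y \<partial>dn i)"
      using integrable_mult_indicator[OF _ p_int] A
      by (intro K.product_integral_prod) auto
    finally show "L_fc A = I_fc (\<Pi>\<^sub>E i\<in>UNIV. A i)"
      by (simp add: L_fc_def set_lebesgue_integral_def)
  qed
  have b: "A i \<in> sets (dn i) \<and> A i \<subseteq> P i \<and> A i \<subseteq> admissible i"
    if d: "\<And>k. k \<in> {1..nv} \<Longrightarrow> d k \<in> range ((*v) (B i)) \<and> d k \<noteq> 0 \<and>
        (\<exists>\<theta> \<alpha>. vlp_feasible \<mu> x g nbar i (d k) \<theta> \<alpha>)"
      and A: "A i = (+) (nbar i) `
        (convex hull ((\<lambda>k. vlp_value \<mu> x g nbar i (d k) *\<^sub>R d k) ` {1..nv}))"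
    for nv :: nat and d A i
  proof -
    let ?V = "(\<lambda>k. vlp_value \<mu> x g nbar i (d k) *\<^sub>R d k) ` {1..nv}"
    \<comment> \<open>The hull of finitely many points is compact, so its translate is closed; this
      supplies the measurability demanded in (a).\<close>
    have "compact (convex hull ?V)" by (intro compact_convex_hull finite_imp_compact) simp
    then have "closed (A i)" unfolding A by (intro compact_imp_closed compact_translation)
    then have 1: "A i \<in> sets (dn i)" by (intro sets_dn borel_closed)
    \<comment> \<open>The scaled directions stay in the linear space parallel to the plane, and with
      them their convex hull.\<close>
    have "subspace (range ((*v) (B i)))"
      by (intro linear_subspace_image subspace_UNIV matrix_vector_mul_linear)
    then have "convex hull ?V \<subseteq> range ((*v) (B i))"
      using d by (intro hull_minimal subspace_imp_convex) (auto intro: subspace_scale)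
    then have 2: "A i \<subseteq> P i" unfolding A P_def affine_plane_def by blast
    \<comment> \<open>The linear preimage of a convex set is convex, so only the vertices have to be
      tested, one edge \<open>j\<close> at a time.\<close>
    have "convex hull ?V \<subseteq> (*v) (T i j) -` (uminus ` C nbar)" for j
    proof (rule hull_minimal)
      show "?V \<subseteq> (*v) (T i j) -` (uminus ` C nbar)"
        using d unfolding T_def C_def by (auto intro!: vlp_value_wrench_hull)
      show "convex ((*v) (T i j) -` (uminus ` C nbar))"
        unfolding C_def
        by (intro convex_linear_vimage matrix_vector_mul_linear convex_negations convex_wrench_hull)
    qed
    with 1 2 show ?thesis unfolding admissible_def A by fastforce
  qed
  show ?thesis
  proof (rule conjI; intro allI impI)
    fix A assume "\<forall>i. A i \<in> sets (dn i) \<and> A i \<subseteq> P i \<and> A i \<subseteq> admissible i"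
    then have "\<And>i. A i \<in> sets (dn i) \<and> A i \<subseteq> P i \<and> A i \<subseteq> admissible i" by (rule spec)
    then show "(\<Pi>\<^sub>E i\<in>UNIV. A i) \<subseteq> N \<and> L_fc A = I_fc (\<Pi>\<^sub>E i\<in>UNIV. A i) \<and>
        I_fc (\<Pi>\<^sub>E i\<in>UNIV. A i) \<le> I_fc N \<and> I_fc N = P_fc"
      by (rule a)
  next
    fix nv :: nat and d A
    assume H: "(\<forall>i. \<forall>k\<in>{1..nv}. d i k \<in> range ((*v) (B i)) \<and> d i k \<noteq> 0 \<and>
          (\<exists>\<theta> \<alpha>. vlp_feasible \<mu> x g nbar i (d i k) \<theta> \<alpha>)) \<and>
        (\<forall>i. A i = (+) (nbar i) `
          (convex hull ((\<lambda>k. vlp_value \<mu> x g nbar i (d i k) *\<^sub>R d i k) ` {1..nv})))"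
    have adm: "A i \<in> sets (dn i) \<and> A i \<subseteq> P i \<and> A i \<subseteq> admissible i" for i
    proof (rule b)
      show "d i k \<in> range ((*v) (B i)) \<and> d i k \<noteq> 0 \<and>
          (\<exists>\<theta> \<alpha>. vlp_feasible \<mu> x g nbar i (d i k) \<theta> \<alpha>)" if "k \<in> {1..nv}" for k
        by (rule bspec[OF spec[OF conjunct1[OF H]] that])
      show "A i = (+) (nbar i) `
          (convex hull ((\<lambda>k. vlp_value \<mu> x g nbar i (d i k) *\<^sub>R d i k) ` {1..nv}))"
        by (rule spec[OF conjunct2[OF H]])
    qed
    have "L_fc A \<le> P_fc" using a[OF adm] by linarith
    then show "(\<forall>i. A i \<in> sets (dn i) \<and> A i \<subseteq> P i \<and> A i \<subseteq> admissible i) \<and> L_fc A \<le> P_fc"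
      by (rule conjI[OF allI[OF adm]])
  qed
qed

end
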